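(* There exists a unique $\lambda\in\left(\frac{\pi}{4},\frac{\pi}{2}\right)$ such that $\cosh^3\lambda\cdot\cos^2\lambda=1$. For any $x\in(0,\lambda)$ one has $\cosh^3 x\cdot\cos^2 x>1$, and for any $x\in\left(\lambda,\frac{\pi}{2}\right)$ one has $\cosh^3 x\cdot\cos^2 x<1$. *)

theory Defs
  imports Complex_Main
begin

end

theory Submission
  imports Defs
begin

text \<open>
  With \<open>g = 3 sinh cos - 2 cosh sin\<close>, the derivative of \<open>f = cosh\<^sup>3 cos\<^sup>2\<close> is \<open>cosh\<^sup>2 cos g\<close>, and \<open>g\<close> is
  strictly concave on \<open>[0, pi/2]\<close> with \<open>g 0 = 0\<close>. Hence once \<open>g\<close> is nonpositive it stays negative, so
  that once \<open>f\<close> has fallen back to its initial value \<open>f 0 = 1\<close> it decreases strictly. Therefore \<open>f\<close>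
  takes the value 1 exactly once on \<open>(0, pi/2)\<close>, and \<open>f (pi/4) > 1\<close> locates this point.
\<close>

text \<open>The mean value theorem on \<open>[a, x]\<close> yields a point of nonpositive slope. By
  \<open>stays_neg\<close> all later slopes before \<open>y\<close> are negative, among them the
  mean slope over \<open>[x, y]\<close>. This serves twice: for the function itself and for the
  factor \<open>g\<close> of its derivative.\<close>

lemma decreasing_below_initial_value:
  fixes f f' :: "real \<Rightarrow> real"
  assumes "a < x" "x < y"
    and deriv: "\<And>t. \<lbrakk>a \<le> t; t \<le> y\<rbrakk> \<Longrightarrow> (f has_real_derivative f' t) (at t)"
    and stays_neg: "\<And>s t. \<lbrakk>a < s; s < t; t < y; f' s \<le> 0\<rbrakk> \<Longrightarrow> f' t < 0"
    and "f x \<le> f a"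
  shows "f y < f x"
proof -
  obtain s where s: "a < s" "s < x" "f x - f a = (x - a) * f' s"
    using MVT2[of a x f f'] deriv assms(1,2) by force
  have "f' s \<le> 0"
    using s \<open>a < x\<close> \<open>f x \<le> f a\<close> by (smt (verit) mult_pos_pos)
  obtain t where t: "x < t" "t < y" "f y - f x = (y - x) * f' t"
    using MVT2[of x y f f'] deriv assms(1,2) by force
  have "f' t < 0"
    using stays_neg[of s t] s t \<open>f' s \<le> 0\<close> by simp
  then show ?thesis
    using t \<open>x < y\<close> by (smt (verit) mult_pos_neg)
qed

lemma cosh_cos_deriv_stays_neg:
  fixes x y :: real
  assumes "0 < x" "x < y" "y < pi/2"
    and nonpos: "3 * sinh x * cos x - 2 * cosh x * sin x \<le> 0"
  shows "3 * sinh y * cos y - 2 * cosh y * sin y < 0"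
proof -
  let ?g = "\<lambda>t::real. 3 * sinh t * cos t - 2 * cosh t * sin t"
  let ?g' = "\<lambda>t::real. cosh t * cos t - 5 * sinh t * sin t"
  have "?g y < ?g x"
  proof (rule decreasing_below_initial_value[where a = 0 and f = ?g and f' = ?g'])
    fix t :: real
    show "(?g has_real_derivative ?g' t) (at t)"
      by (auto intro!: derivative_eq_intros simp: algebra_simps)
  next
    fix s t :: real
    assume "0 < s" "s < t" "t < y" "?g' s \<le> 0"
    \<comment> \<open>Strict concavity: both terms subtracted in the second derivative of
      \<open>?g\<close> are positive on \<open>(0, pi/2)\<close>.\<close>
    have "?g' t < ?g' s"
    proof (rule DERIV_neg_imp_decreasing[OF \<open>s < t\<close>])
      fix u assume "s \<le> u" "u \<le> t"
      then have u: "0 < u" "u < pi/2"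
        using \<open>0 < s\<close> \<open>t < y\<close> \<open>y < pi/2\<close> by auto
      have "(?g' has_real_derivative - (4 * (sinh u * cos u) + 6 * (cosh u * sin u))) (at u)"
        by (auto intro!: derivative_eq_intros simp: algebra_simps)
      moreover have "0 < sinh u * cos u" "0 < cosh u * sin u"
        using u by (auto intro!: mult_pos_pos cos_gt_zero sin_gt_zero)
      ultimately show "\<exists>z. (?g' has_real_derivative z) (at u) \<and> z < 0"
        by (smt (verit))
    qed
    with \<open>?g' s \<le> 0\<close> show "?g' t < 0" by simp
  qed (use assms in auto)
  with nonpos show ?thesis by simp
qed

lemma cosh_cos_decreasing:
  fixes x y :: real
  assumes "0 < x" "x < y" "y < pi/2" "cosh x ^ 3 * cos x ^ 2 \<le> 1"
  shows "cosh y ^ 3 * cos y ^ 2 < cosh x ^ 3 * cos x ^ 2"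
proof (rule decreasing_below_initial_value[where a = 0
      and f = "\<lambda>t. cosh t ^ 3 * cos t ^ 2"
      and f' = "\<lambda>t. (cosh t ^ 2 * cos t) * (3 * sinh t * cos t - 2 * cosh t * sin t)"])
  fix t :: real
  show "((\<lambda>t. cosh t ^ 3 * cos t ^ 2) has_real_derivative
      (cosh t ^ 2 * cos t) * (3 * sinh t * cos t - 2 * cosh t * sin t)) (at t)"
    by (auto intro!: derivative_eq_intros simp: algebra_simps power2_eq_square power3_eq_cube)
next
  fix s t :: real
  assume st: "0 < s" "s < t" "t < y"
    and "(cosh s ^ 2 * cos s) * (3 * sinh s * cos s - 2 * cosh s * sin s) \<le> 0"
  \<comment> \<open>The first factor is positive, so the derivative has the sign of the second, to
    which \<open>cosh_cos_deriv_stays_neg\<close> applies.\<close>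
  moreover have "0 < cosh s ^ 2 * cos s" "0 < cosh t ^ 2 * cos t"
    using st \<open>y < pi/2\<close> by (auto intro!: mult_pos_pos cos_gt_zero)
  ultimately show "(cosh t ^ 2 * cos t) * (3 * sinh t * cos t - 2 * cosh t * sin t) < 0"
    using cosh_cos_deriv_stays_neg[of s t] st \<open>y < pi/2\<close>
    by (smt (verit) mult_pos_pos mult_pos_neg)
qed (use assms in auto)

lemma sinh_ge_self:
  fixes x :: real
  assumes "0 \<le> x"
  shows "x \<le> sinh x"
proof -
  have "sinh 0 - 0 \<le> sinh x - x"
  proof (rule DERIV_nonneg_imp_nondecreasing[OF assms])
    fix t :: real
    have "((\<lambda>x. sinh x - x) has_real_derivative (cosh t - 1)) (at t)"
      by (auto intro!: derivative_eq_intros)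
    then show "\<exists>z. ((\<lambda>x. sinh x - x) has_real_derivative z) (at t) \<and> 0 \<le> z"
      using cosh_real_ge_1[of t] by auto
  qed
  then show ?thesis by simp
qed

text \<open>As \<open>cos (pi/4) ^ 2\<close> is 1/2, the cube of \<open>cosh (pi/4)\<close> has to
  exceed 2. The bound 41/32 = 1 + 2 * (3/8)^2 suffices, its cube being about 2.10.\<close>

lemma cosh_cos_pi_quarter_gt_1: "1 < cosh (pi/4) ^ 3 * cos (pi/4) ^ 2"
proof -
  \<comment> \<open>This is sin x \<le> x at pi/6, where the sine is 1/2.\<close>
  have "3 \<le> pi"
    using sin_x_le_x[of "pi/6"] by (simp add: sin_30)
  then have "3/8 \<le> sinh (pi/8)"
    using sinh_ge_self[of "pi/8"] by simp
  then have "(3/8)\<^sup>2 \<le> sinh (pi/8) ^ 2"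
    by (intro power_mono) auto
  moreover have "cosh (pi/4) = 1 + 2 * sinh (pi/8) ^ 2"
    using cosh_double[of "pi/8"] cosh_square_eq[of "pi/8"] by simp
  ultimately have "41/32 \<le> cosh (pi/4)"
    by (simp add: power2_eq_square)
  then have "(41/32) ^ 3 \<le> cosh (pi/4) ^ 3"
    by (intro power_mono) auto
  then show ?thesis
    by (simp add: cos_45 power_divide power3_eq_cube)
qed

theorem theorem4p7:
  shows "(\<exists>!l::real. l \<in> {pi/4<..<pi/2} \<and> cosh l ^ 3 * cos l ^ 2 = 1) \<and>
    (\<forall>l::real. l \<in> {pi/4<..<pi/2} \<and> cosh l ^ 3 * cos l ^ 2 = 1 \<longrightarrow>
      (\<forall>x\<in>{0<..<l}. cosh x ^ 3 * cos x ^ 2 > 1) \<and>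
      (\<forall>x\<in>{l<..<pi/2}. cosh x ^ 3 * cos x ^ 2 < 1))"
proof -
  let ?f = "\<lambda>x::real. cosh x ^ 3 * cos x ^ 2"
  \<comment> \<open>\<open>?f\<close> exceeds 1 at pi/4 and vanishes at pi/2.\<close>
  have "\<exists>l\<ge>pi/4. l \<le> pi/2 \<and> ?f l = 1"
    by (rule IVT2') (use cosh_cos_pi_quarter_gt_1 in \<open>auto intro!: continuous_intros\<close>)
  then obtain l where l: "pi/4 \<le> l" "l \<le> pi/2" "?f l = 1" by blast
  moreover have "l \<noteq> pi/4" "l \<noteq> pi/2"
    using l(3) cosh_cos_pi_quarter_gt_1 by fastforce+
  ultimately have "l \<in> {pi/4<..<pi/2}" by simp
  have above: "?f y < 1" if "0 < x" "x < y" "y < pi/2" "?f x \<le> 1" for x y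
    using cosh_cos_decreasing[OF that] that by linarith
  \<comment> \<open>Of two distinct solutions, the smaller would force a value below 1 at the
    larger.\<close>
  have "l' = l" if "l' \<in> {pi/4<..<pi/2}" "?f l' = 1" for l'
    using above[of l l'] above[of l' l] that l \<open>l \<in> {pi/4<..<pi/2}\<close> pi_gt_zero
    by (cases l l' rule: linorder_cases) auto
  then have "\<exists>!l. l \<in> {pi/4<..<pi/2} \<and> ?f l = 1"
    using \<open>l \<in> {pi/4<..<pi/2}\<close> \<open>?f l = 1\<close> by blast
  moreover have "(\<forall>x\<in>{0<..<k}. ?f x > 1) \<and> (\<forall>x\<in>{k<..<pi/2}. ?f x < 1)"
    if "k \<in> {pi/4<..<pi/2}" "?f k = 1" for k
  proof (intro conjI ballI)
    fix x assume "x \<in> {0<..<k}"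
    \<comment> \<open>Otherwise \<open>above\<close> would give \<open>?f k < 1\<close>.\<close>
    then show "?f x > 1"
      using above[of x k] that by (intro not_le_imp_less) auto
  next
    fix x assume "x \<in> {k<..<pi/2}"
    moreover have "0 < k"
      using that pi_gt_zero by (auto intro: less_trans[of 0 "pi/4"])
    ultimately show "?f x < 1"
      using above[of k x] that by auto
  qed
  ultimately show ?thesis by blast
qed

end
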